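(* Let $Y$ be a real topological vector space, $D$ a nonempty subset of $Y$, $C$ a non-trivial closed convex pointed cone in $Y$ with $k\in\operatorname{core}C$, $a\in Y$, and $F\subset Y$ with $F\subseteq a+C$. Define $\Psi:=\operatorname{argmin}_{y\in F}\|y-a\|_{C,k}$. Then: (a) $\operatorname{Eff}(F,D)\cap\Psi\subseteq\operatorname{Eff}(\Psi,D)$. (b) If $C+D\subseteq C$, then $\operatorname{Eff}(F,D)\cap\Psi=\operatorname{Eff}(\Psi,D)$. (c) If $C+D\subseteq C$ and $\Psi=\{y^0\}$, then $y^0\in\operatorname{Eff}(F,D)$. (d) If $C+(D\setminus\{0\})\subseteq\operatorname{core}C$, then $\Psi\subseteq\operatorname{Eff}(F,D)$. (e) If $C+\operatorname{int}D\subseteq C$, then $\Psi\subseteq\operatorname{WEff}(F,D)$.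
   Context: $\operatorname{Eff}(F,D):=\{y^0\in F\mid F\cap(y^0-D)\subseteq\{y^0\}\}$ and $\operatorname{WEff}(F,D):=\operatorname{Eff}(F,\operatorname{int}D)$. A set $C\subseteq Y$ is a cone if $\mathbb{R}_+C\subseteq C$ with $\mathbb{R}_+=\{x\in\mathbb{R}\mid x\ge0\}$; it is non-trivial if $C\neq\emptyset$, $C\neq\{0\}$, $C\neq Y$; pointed if $C\cap(-C)=\{0\}$. $\operatorname{core}A$ is the algebraic interior of $A$. $\|\cdot\|_{C,k}$ denotes the norm given as the Minkowski functional of the order interval $[-k,k]_C=(-k+C)\cap(k-C)$. $\operatorname{argmin}_{y\in F}\|y-a\|_{C,k}$ is the set of minimizers on $F$ (empty if no minimum is attained). *)

theory Defs
  imports "HOL-Analysis.Analysis"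
begin

text \<open>
  Real topological vector spaces. Joint continuity of scalar multiplication is stated in the
  same form as \<open>tendsto_add_Pair\<close> in class \<^class>\<open>topological_monoid_add\<close>. No separation axiom
  is assumed.
\<close>

class topological_real_vector = real_vector + topological_ab_group_add +
  assumes tendsto_scaleR_Pair:
    "((\<lambda>x. fst x *\<^sub>R snd x) \<longlongrightarrow> r *\<^sub>R a) (nhds r \<times>\<^sub>F nhds a)"

instance real_normed_vector \<subseteq> topological_real_vector
proof
  fix r :: real and a :: 'a
  show "((\<lambda>x. fst x *\<^sub>R snd x) \<longlongrightarrow> r *\<^sub>R a) (nhds r \<times>\<^sub>F nhds a)"
    by (intro tendsto_scaleR filterlim_fst filterlim_snd)
qed

definition Eff :: "'a::real_vector set \<Rightarrow> 'a set \<Rightarrow> 'a set" where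
  "Eff F D = {y0 \<in> F. F \<inter> (\<lambda>d. y0 - d) ` D \<subseteq> {y0}}"

definition WEff :: "'a::topological_real_vector set \<Rightarrow> 'a set \<Rightarrow> 'a set" where
  "WEff F D = Eff F (interior D)"

definition algebraic_interior :: "'a::real_vector set \<Rightarrow> 'a set" where
  "algebraic_interior A = {x. \<forall>v. \<exists>\<epsilon>>0. \<forall>t\<in>{0..\<epsilon>}. x + t *\<^sub>R v \<in> A}"

definition pointed :: "'a::real_vector set \<Rightarrow> bool" where
  "pointed C \<longleftrightarrow> C \<inter> uminus ` C = {0}"

definition order_interval :: "'a::real_vector set \<Rightarrow> 'a \<Rightarrow> 'a \<Rightarrow> 'a set" where
  "order_interval C a b = (\<lambda>c. a + c) ` C \<inter> (\<lambda>c. b - c) ` C"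

text \<open>
  The infimum is a real number, hence meaningful only where \<open>A\<close> absorbs \<open>y\<close>. The order interval
  used below absorbs every point if \<open>C\<close> is a convex cone and \<open>k\<close> belongs to its algebraic interior.
\<close>

definition minkowski_functional :: "'a::real_vector set \<Rightarrow> 'a \<Rightarrow> real" where
  "minkowski_functional A y = Inf {t. t > 0 \<and> y \<in> (\<lambda>x. t *\<^sub>R x) ` A}"

definition cone_norm :: "'a::real_vector set \<Rightarrow> 'a \<Rightarrow> 'a \<Rightarrow> real" where
  "cone_norm C k = minkowski_functional (order_interval C (- k) k)"

definition argmin_set :: "('a \<Rightarrow> real) \<Rightarrow> 'a set \<Rightarrow> 'a set" where
  "argmin_set f F = {y \<in> F. \<forall>z\<in>F. f y \<le> f z}"

end

theory Submission
  imports Defs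
begin

text \<open>
  On the cone \<open>C\<close> the order interval norm only sees the upper bound:
  \<open>y \<in> C\<close> has norm \<open>Inf {t > 0. t k - y \<in> C}\<close>. It is therefore monotone on \<open>C\<close> for the
  order induced by \<open>C\<close>, and it drops strictly when a point of \<open>C\<close> is lowered, inside \<open>C\<close>, by
  an element \<open>d\<close> that still dominates a positive multiple of \<open>k\<close>
  (\<open>cone_norm_mono\<close>, \<open>cone_norm_strict\<close>).

  The hypothesis \<open>F \<subseteq> a + C\<close> puts every \<open>y - a\<close> in the region where these facts apply, and each
  condition on \<open>D\<close> says how the norm changes when passing from \<open>y0\<close> to a competitor
  \<open>y0 - d \<in> F\<close>. If \<open>C + D \<subseteq> C\<close>, then \<open>d \<in> C\<close>, so the competitor of a minimizer is again a
  minimizer: efficiency among the minimizers is efficiency in \<open>F\<close>. If \<open>d\<close> lies in the algebraic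
  interior of \<open>C\<close> or in an open subset of \<open>C\<close>, then \<open>d - \<epsilon> k \<in> C\<close> for some \<open>\<epsilon> > 0\<close>, so the
  competitor would be strictly better than a minimizer, and no competitor exists.
\<close>

section \<open>Algebraic interior\<close>

lemma algebraic_interior_subset: "algebraic_interior A \<subseteq> A"
  by (force simp: algebraic_interior_def)

text \<open>
  The direction \<open>- k\<close> stays inside \<open>A\<close> for a while; this is the form in which interior points
  yield a strict decrease of the norm.
\<close>

lemma algebraic_interior_diff_scaleR:
  assumes "d \<in> algebraic_interior A"
  shows "\<exists>\<epsilon>>0. d - \<epsilon> *\<^sub>R k \<in> A"
proof -
  obtain \<epsilon> where "\<epsilon> > 0" "\<forall>t\<in>{0..\<epsilon>}. d + t *\<^sub>R (- k) \<in> A"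
    using assms unfolding algebraic_interior_def by blast
  then show ?thesis
    by (intro exI[of _ \<epsilon>]) auto
qed

text \<open>Here the topology enters: scalar multiplication is continuous at \<open>0\<close> along a fixed vector.\<close>

lemma open_subset_algebraic_interior:
  fixes U :: "'a::topological_real_vector set"
  assumes "open U"
  shows "U \<subseteq> algebraic_interior U"
  unfolding algebraic_interior_def
proof (intro subsetI CollectI allI)
  fix x v :: 'a assume "x \<in> U"
  have "filterlim (\<lambda>t::real. (t, v)) (nhds 0 \<times>\<^sub>F nhds v) (nhds 0)"
    by (intro filterlim_Pair filterlim_ident tendsto_const)
  from filterlim_compose[OF tendsto_scaleR_Pair this]
  have "((\<lambda>t::real. t *\<^sub>R v) \<longlongrightarrow> 0) (nhds 0)"
    by simp
  then have "((\<lambda>t::real. x + t *\<^sub>R v) \<longlongrightarrow> x) (nhds 0)"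
    using tendsto_add[OF tendsto_const[of x]] by fastforce
  then have "eventually (\<lambda>t. x + t *\<^sub>R v \<in> U) (nhds (0::real))"
    using assms \<open>x \<in> U\<close> by (rule topological_tendstoD)
  then obtain e where "e > 0" "\<And>t. dist t 0 < e \<Longrightarrow> x + t *\<^sub>R v \<in> U"
    by (auto simp: eventually_nhds_metric)
  then show "\<exists>\<epsilon>>0. \<forall>t\<in>{0..\<epsilon>}. x + t *\<^sub>R v \<in> U"
    by (intro exI[of _ "e / 2"]) auto
qed

section \<open>Monotonicity of the order interval norm\<close>

lemma mem_scaled_order_interval:
  assumes "cone C" "t > 0"
  shows "y \<in> (\<lambda>x. t *\<^sub>R x) ` order_interval C (- k) k \<longleftrightarrow>
    y + t *\<^sub>R k \<in> C \<and> t *\<^sub>R k - y \<in> C"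
proof
  assume "y \<in> (\<lambda>x. t *\<^sub>R x) ` order_interval C (- k) k"
  then obtain c c' where c: "c \<in> C" "c' \<in> C" "y = t *\<^sub>R (- k + c)" "y = t *\<^sub>R (k - c')"
    by (auto simp: order_interval_def)
  have "y + t *\<^sub>R k = t *\<^sub>R c"
    using c(3) by (simp add: algebra_simps)
  moreover have "t *\<^sub>R k - y = t *\<^sub>R c'"
    using c(4) by (simp add: algebra_simps)
  ultimately show "y + t *\<^sub>R k \<in> C \<and> t *\<^sub>R k - y \<in> C"
    using c(1,2) assms by (simp add: cone_def)
next
  assume y: "y + t *\<^sub>R k \<in> C \<and> t *\<^sub>R k - y \<in> C"
  define x where "x = (1 / t) *\<^sub>R y"
  have "(1 / t) *\<^sub>R (y + t *\<^sub>R k) \<in> C" "(1 / t) *\<^sub>R (t *\<^sub>R k - y) \<in> C"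
    using y assms by (simp_all add: cone_def)
  then have "x + k \<in> C" "k - x \<in> C"
    using assms by (simp_all add: x_def algebra_simps)
  moreover have "x = - k + (x + k)" "x = k - (k - x)"
    by simp_all
  ultimately have "x \<in> order_interval C (- k) k"
    unfolding order_interval_def by blast
  moreover have "y = t *\<^sub>R x"
    using assms by (simp add: x_def)
  ultimately show "y \<in> (\<lambda>x. t *\<^sub>R x) ` order_interval C (- k) k"
    by blast
qed

text \<open>The lower bound \<open>- t k \<le> y\<close> is automatic because \<open>y\<close> and \<open>k\<close> are nonnegative.\<close>

lemma cone_norm_on_cone:
  assumes "cone C" "convex C" "k \<in> algebraic_interior C" "y \<in> C"
  shows "cone_norm C k y = Inf {t. t > 0 \<and> t *\<^sub>R k - y \<in> C}"
proof -
  have "k \<in> C"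
    using assms(3) algebraic_interior_subset by blast
  then have "y + t *\<^sub>R k \<in> C" if "t > 0" for t
    using assms that convex_cone[of C] by simp
  then have "{t. t > 0 \<and> y \<in> (\<lambda>x. t *\<^sub>R x) ` order_interval C (- k) k}
      = {t. t > 0 \<and> t *\<^sub>R k - y \<in> C}"
    using mem_scaled_order_interval[OF assms(1)] by blast
  then show ?thesis
    by (simp add: cone_norm_def minkowski_functional_def)
qed

text \<open>
  An interior \<open>k\<close> is an order unit. This makes the infimum defining the norm a genuine one, over a
  nonempty set.
\<close>

lemma algebraic_interior_order_unit:
  assumes "cone C" "k \<in> algebraic_interior C"
  shows "\<exists>t>0. t *\<^sub>R k - y \<in> C"
proof -
  obtain \<epsilon> where \<epsilon>: "\<epsilon> > 0" "k - \<epsilon> *\<^sub>R y \<in> C"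
    using algebraic_interior_diff_scaleR[OF assms(2)] by blast
  then have "(1 / \<epsilon>) *\<^sub>R (k - \<epsilon> *\<^sub>R y) \<in> C"
    using assms(1) by (simp add: cone_def)
  then show ?thesis
    using \<epsilon> by (intro exI[of _ "1 / \<epsilon>"]) (simp add: algebra_simps)
qed

text \<open>
  The common core of both comparisons of norms, which compare the infima termwise. The plain
  monotonicity is \<open>s = 0\<close>; a decrease that survives passing to the infimum needs one \<open>s > 0\<close> that
  works for all \<open>t\<close>.
\<close>

lemma cone_norm_le_diffI:
  assumes C: "cone C" "convex C" "k \<in> algebraic_interior C" and yz: "y \<in> C" "z \<in> C"
    and shift: "\<And>t. t > 0 \<Longrightarrow> t *\<^sub>R k - z \<in> C \<Longrightarrow> t - s > 0 \<and> (t - s) *\<^sub>R k - y \<in> C"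
  shows "cone_norm C k y \<le> cone_norm C k z - s"
proof -
  let ?S = "\<lambda>y. {t. t > 0 \<and> t *\<^sub>R k - y \<in> C}"
  have "Inf (?S y) + s \<le> Inf (?S z)"
  proof (rule cInf_greatest)
    show "?S z \<noteq> {}"
      using algebraic_interior_order_unit[OF C(1,3)] by blast
  next
    fix t assume "t \<in> ?S z"
    then have "t - s \<in> ?S y"
      using shift by blast
    moreover have "bdd_below (?S y)"
      by (intro bdd_belowI[of _ 0]) auto
    ultimately have "Inf (?S y) \<le> t - s"
      by (rule cInf_lower)
    then show "Inf (?S y) + s \<le> t"
      by simp
  qed
  then show ?thesis
    using cone_norm_on_cone[OF C] yz by simp
qed

lemma cone_norm_mono:
  assumes C: "cone C" "convex C" "k \<in> algebraic_interior C"
    and y: "y \<in> C" and d: "d \<in> C"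
  shows "cone_norm C k y \<le> cone_norm C k (y + d)"
proof -
  have add: "u + v \<in> C" if "u \<in> C" "v \<in> C" for u v
    using that C convex_cone[of C] by blast
  have "t *\<^sub>R k - y \<in> C" if "t *\<^sub>R k - (y + d) \<in> C" for t
    using add[OF that d] by (simp add: algebra_simps)
  then show ?thesis
    using cone_norm_le_diffI[OF C y add[OF y d], of 0] by simp
qed

text \<open>
  Every \<open>t\<close> admissible for \<open>y + d\<close> satisfies \<open>(t - \<epsilon>) k \<ge> y \<ge> 0\<close>. Since \<open>C\<close> is pointed and
  proper, \<open>- k \<notin> C\<close>, which forces \<open>t \<ge> \<epsilon>\<close>; hence \<open>t\<close> can be lowered by the fixed amount
  \<open>\<epsilon> / 2\<close> and stays positive.
\<close>

lemma cone_norm_strict: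
  assumes C: "cone C" "convex C" "k \<in> algebraic_interior C"
    and "pointed C" "C \<noteq> UNIV"
    and y: "y \<in> C" and d: "\<epsilon> > 0" "d - \<epsilon> *\<^sub>R k \<in> C"
  shows "cone_norm C k y < cone_norm C k (y + d)"
proof -
  have kC: "k \<in> C"
    using C(3) algebraic_interior_subset by blast
  have add: "u + v \<in> C" if "u \<in> C" "v \<in> C" for u v
    using that C convex_cone[of C] by blast
  have scale: "c *\<^sub>R u \<in> C" if "u \<in> C" "c \<ge> 0" for u c
    using that C by (simp add: cone_def)
  have neg: "- k \<notin> C"
  proof
    assume "- k \<in> C"
    then have "k \<in> C \<inter> uminus ` C"
      using kC by (simp add: image_iff) (metis minus_minus)
    then have "k = 0"
      using \<open>pointed C\<close> by (auto simp: pointed_def)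
    \<comment> \<open>an interior \<open>0\<close> absorbs every vector\<close>
    then have "- y \<in> C" for y
      using algebraic_interior_order_unit[OF C(1,3), of y] by simp
    then have "C = UNIV"
      by (metis UNIV_eq_I minus_minus)
    with \<open>C \<noteq> UNIV\<close> show False ..
  qed
  have dC: "d \<in> C"
    using add[OF d(2) scale[OF kC, of \<epsilon>]] d(1) by simp
  have "cone_norm C k y \<le> cone_norm C k (y + d) - \<epsilon> / 2"
  proof (rule cone_norm_le_diffI[OF C y add[OF y dC]])
    fix t :: real assume "t > 0" and t: "t *\<^sub>R k - (y + d) \<in> C"
    have ty: "(t - \<epsilon>) *\<^sub>R k - y \<in> C"
      using add[OF t d(2)] by (simp add: algebra_simps)
    have "t \<ge> \<epsilon>"
    proof (rule ccontr)
      assume "\<not> t \<ge> \<epsilon>"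
      moreover have "(t - \<epsilon>) *\<^sub>R k \<in> C"
        using add[OF ty y] by simp
      ultimately have "(1 / (\<epsilon> - t)) *\<^sub>R ((t - \<epsilon>) *\<^sub>R k) \<in> C"
        using scale[of "(t - \<epsilon>) *\<^sub>R k" "1 / (\<epsilon> - t)"] by simp
      moreover have "(t - \<epsilon>) / (\<epsilon> - t) = -1"
        using \<open>\<not> t \<ge> \<epsilon>\<close> by (simp add: field_simps)
      ultimately show False
        using neg by simp
    qed
    have "((t - \<epsilon>) + \<epsilon> / 2) *\<^sub>R k - y = ((t - \<epsilon>) *\<^sub>R k - y) + (\<epsilon> / 2) *\<^sub>R k"
      unfolding scaleR_left_distrib by (rule diff_add_eq[symmetric])
    also have "\<dots> \<in> C"
      using d(1) by (intro add[OF ty] scale[OF kC]) simp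
    also have "(t - \<epsilon>) + \<epsilon> / 2 = t - \<epsilon> / 2"
      by simp
    finally have "(t - \<epsilon> / 2) *\<^sub>R k - y \<in> C" .
    with \<open>t \<ge> \<epsilon>\<close> show "t - \<epsilon> / 2 > 0 \<and> (t - \<epsilon> / 2) *\<^sub>R k - y \<in> C"
      using d(1) by simp
  qed
  then show ?thesis
    using d(1) by simp
qed

section \<open>Efficient points and norm minimizers\<close>

lemma Eff_subset_inter:
  assumes "\<Psi> \<subseteq> F"
  shows "Eff F D \<inter> \<Psi> \<subseteq> Eff \<Psi> D"
  using assms by (auto simp: Eff_def)

theorem theorem11:
  fixes C D F \<Psi> :: "'a::topological_real_vector set" and a k :: 'a
  assumes "D \<noteq> {}"
    and "cone C" and "C \<noteq> {}" and "C \<noteq> {0}" and "C \<noteq> UNIV"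
    and "closed C" and "convex C" and "pointed C"
    and "k \<in> algebraic_interior C"
    and "F \<subseteq> (\<lambda>c. a + c) ` C"
    and "\<Psi> = argmin_set (\<lambda>y. cone_norm C k (y - a)) F"
  shows "(Eff F D \<inter> \<Psi> \<subseteq> Eff \<Psi> D) \<and>
    (C + D \<subseteq> C \<longrightarrow> Eff F D \<inter> \<Psi> = Eff \<Psi> D) \<and>
    (\<forall>y0. C + D \<subseteq> C \<and> \<Psi> = {y0} \<longrightarrow> y0 \<in> Eff F D) \<and>
    (C + (D - {0}) \<subseteq> algebraic_interior C \<longrightarrow> \<Psi> \<subseteq> Eff F D) \<and>
    (C + interior D \<subseteq> C \<longrightarrow> \<Psi> \<subseteq> WEff F D)"
proof -
  let ?p = "\<lambda>y. cone_norm C k (y - a)"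
  note C = \<open>cone C\<close> \<open>convex C\<close> \<open>k \<in> algebraic_interior C\<close>
  have \<Psi>_iff: "y \<in> \<Psi> \<longleftrightarrow> y \<in> F \<and> (\<forall>z\<in>F. ?p y \<le> ?p z)" for y
    using \<open>\<Psi> = _\<close> by (simp add: argmin_set_def)
  have F: "y - a \<in> C" if "y \<in> F" for y
    using that \<open>F \<subseteq> _\<close> by auto
  \<comment> \<open>since \<open>0 \<in> C\<close>, the conditions on \<open>C + E\<close> constrain \<open>E\<close> itself\<close>
  have E_sub: "E \<subseteq> A" if "C + E \<subseteq> A" for E A
  proof
    fix e assume "e \<in> E"
    moreover have "0 \<in> C"
      using \<open>pointed C\<close> by (auto simp: pointed_def)
    ultimately have "0 + e \<in> C + E"
      by (rule set_plus_intro[rotated])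
    then show "e \<in> A"
      using that by auto
  qed
  have a: "Eff F D \<inter> \<Psi> \<subseteq> Eff \<Psi> D"
    by (rule Eff_subset_inter) (use \<Psi>_iff in blast)
  have b: "Eff F D \<inter> \<Psi> = Eff \<Psi> D" if "C + D \<subseteq> C"
  proof (intro equalityI a subsetI)
    fix y0 assume y0: "y0 \<in> Eff \<Psi> D"
    then have y0\<Psi>: "y0 \<in> \<Psi>"
      by (simp add: Eff_def)
    have "y0 - d = y0" if "d \<in> D" "y0 - d \<in> F" for d
    proof -
      have "d \<in> C"
        using E_sub[OF \<open>C + D \<subseteq> C\<close>] that(1) by blast
      then have "?p (y0 - d) \<le> cone_norm C k ((y0 - d - a) + d)"
        by (intro cone_norm_mono C F that)
      also have "(y0 - d - a) + d = y0 - a"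
        by simp
      finally have "?p (y0 - d) \<le> ?p y0" .
      then have "y0 - d \<in> \<Psi>"
        using y0\<Psi> that(2) unfolding \<Psi>_iff by (meson order_trans)
      then show ?thesis
        using y0 that(1) unfolding Eff_def by blast
    qed
    then show "y0 \<in> Eff F D \<inter> \<Psi>"
      using y0\<Psi> \<Psi>_iff[of y0] by (auto simp: Eff_def)
  qed
  have c: "y0 \<in> Eff F D" if "C + D \<subseteq> C" "\<Psi> = {y0}" for y0
  proof -
    have "y0 \<in> Eff \<Psi> D"
      unfolding Eff_def that(2) by blast
    then show ?thesis
      using b[OF that(1)] by blast
  qed
  have no_competitor: "y0 - d \<notin> F" if y0: "y0 \<in> \<Psi>" and d: "d \<in> algebraic_interior C" for y0 d
  proof
    assume dF: "y0 - d \<in> F"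
    obtain \<epsilon> where "\<epsilon> > 0" "d - \<epsilon> *\<^sub>R k \<in> C"
      using algebraic_interior_diff_scaleR[OF d] by blast
    then have "?p (y0 - d) < cone_norm C k ((y0 - d - a) + d)"
      by (intro cone_norm_strict C \<open>pointed C\<close> \<open>C \<noteq> UNIV\<close> F dF)
    also have "(y0 - d - a) + d = y0 - a"
      by simp
    finally show False
      using y0 dF \<Psi>_iff by (simp add: leD)
  qed
  have d: "\<Psi> \<subseteq> Eff F D" if "C + (D - {0}) \<subseteq> algebraic_interior C"
  proof
    fix y0 assume y0: "y0 \<in> \<Psi>"
    have "d = 0" if "d \<in> D" "y0 - d \<in> F" for d
      using no_competitor[OF y0] E_sub[OF \<open>C + (D - {0}) \<subseteq> _\<close>] that by blast
    then show "y0 \<in> Eff F D"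
      using y0 \<Psi>_iff[of y0] by (auto simp: Eff_def)
  qed
  have e: "\<Psi> \<subseteq> WEff F D" if "C + interior D \<subseteq> C"
  proof
    fix y0 assume y0: "y0 \<in> \<Psi>"
    have "interior D \<subseteq> algebraic_interior (interior D)"
      by (rule open_subset_algebraic_interior) simp
    also have "\<dots> \<subseteq> algebraic_interior C"
      using E_sub[OF that] unfolding algebraic_interior_def by blast
    finally have "y0 - d \<notin> F" if "d \<in> interior D" for d
      using no_competitor[OF y0] that by blast
    then show "y0 \<in> WEff F D"
      using y0 \<Psi>_iff[of y0] by (auto simp: WEff_def Eff_def)
  qed
  show ?thesis
    using a b c d e by blast
qed

end
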